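(* Let $n\ge 8$ be an integer. Then for integers $m$, \[ D(n,2,m)=\begin{cases} n-2 & \text{if } m=4,\\ n-3 & \text{if } 5\le m\le 7,\\ n-4 & \text{if } 8\le m\le 2(n-6)+10. \end{cases} \]
   Context: All graphs are finite and simple. For a vertex $u$ of a graph $G$, $N[u]$ is its closed neighborhood (the set consisting of $u$ and all vertices adjacent to $u$). A set $S\subseteq V(G)$ is dominating if every vertex of $G$ lies in $N[s]$ for some $s\in S$. A vertex $u\in V(G)$ is overdominated by $S$ if $|N[u]\cap S|\ge 2$. The cardinality-redundance $CR(S)$ is the number of vertices of $G$ overdominated by $S$, and $CR(G)$ is the minimum of $CR(S)$ over all dominating sets $S$ of $G$. $\gamma_{CR}(G)$ is the minimum size of a dominating set $S$ with $CR(S)=CR(G)$. For integers $n\ge 1$, $0\le k\le n$ and $0\le m\le\binom n2$, $D(n,k,m)$ is the maximum of $\gamma_{CR}(G)$ over all graphs $G$ with $n$ vertices, $m$ edges and $CR(G)=k$; if no such graph exists, $D(n,k,m)=0$. *)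

theory Defs
  imports Main
begin

type_synonym 'a graph = "'a set \<times> 'a set set"

abbreviation verts :: "'a graph \<Rightarrow> 'a set" where
  "verts G \<equiv> fst G"

abbreviation edges :: "'a graph \<Rightarrow> 'a set set" where
  "edges G \<equiv> snd G"

definition simple_graph :: "'a graph \<Rightarrow> bool" where
  "simple_graph G \<longleftrightarrow> finite (verts G) \<and> (\<forall>e\<in>edges G. e \<subseteq> verts G \<and> card e = 2)"

definition closed_nbhd :: "'a graph \<Rightarrow> 'a \<Rightarrow> 'a set" where
  "closed_nbhd G u = insert u {v \<in> verts G. {u, v} \<in> edges G}"

definition dominating :: "'a graph \<Rightarrow> 'a set \<Rightarrow> bool" where
  "dominating G S \<longleftrightarrow> S \<subseteq> verts G \<and> (\<forall>v\<in>verts G. \<exists>s\<in>S. v \<in> closed_nbhd G s)"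

definition overdominated :: "'a graph \<Rightarrow> 'a set \<Rightarrow> 'a \<Rightarrow> bool" where
  "overdominated G S u \<longleftrightarrow> u \<in> verts G \<and> card (closed_nbhd G u \<inter> S) \<ge> 2"

definition CR_set :: "'a graph \<Rightarrow> 'a set \<Rightarrow> nat" where
  "CR_set G S = card {u. overdominated G S u}"

definition CR :: "'a graph \<Rightarrow> nat" where
  "CR G = Min {CR_set G S |S. dominating G S}"

definition gamma_CR :: "'a graph \<Rightarrow> nat" where
  "gamma_CR G = Min {card S |S. dominating G S \<and> CR_set G S = CR G}"

(* Every finite graph is isomorphic to one whose vertices are natural numbers,
   so nat suffices as the type of vertices. *)
definition graphs_with :: "nat \<Rightarrow> nat \<Rightarrow> nat \<Rightarrow> nat graph set" where
  "graphs_with n k m =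
     {G. simple_graph G \<and> card (verts G) = n \<and> card (edges G) = m \<and> CR G = k}"

definition D :: "nat \<Rightarrow> nat \<Rightarrow> nat \<Rightarrow> nat" where
  "D n k m = (if graphs_with n k m = {} then 0 else Max (gamma_CR ` graphs_with n k m))"

text \<open>The minima and the maximum above range over finite nonempty sets.\<close>

lemma finite_dominating: "simple_graph G \<Longrightarrow> finite {S. dominating G S}"
  by (rule finite_subset[of _ "Pow (verts G)"]) (auto simp: dominating_def simple_graph_def)

lemma dominating_verts: "dominating G (verts G)"
  by (auto simp: dominating_def closed_nbhd_def)

lemma finite_CR_set_values: "simple_graph G \<Longrightarrow> finite {CR_set G S |S. dominating G S}"
  using finite_imageI[OF finite_dominating, of G "CR_set G"] by (simp add: image_Collect)

lemma CR_attained: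
  assumes "simple_graph G"
  shows "\<exists>S. dominating G S \<and> CR_set G S = CR G"
proof -
  have "CR G \<in> {CR_set G S |S. dominating G S}"
    unfolding CR_def using finite_CR_set_values[OF assms] dominating_verts[of G]
    by (intro Min_in) blast+
  then show ?thesis by auto
qed

lemma finite_gamma_CR_values:
  assumes "simple_graph G"
  shows "finite {card S |S. dominating G S \<and> CR_set G S = CR G}"
  by (rule finite_subset[OF _ finite_imageI[OF finite_dominating[OF assms], of card]]) auto

lemma gamma_CR_attained:
  assumes "simple_graph G"
  shows "\<exists>S. dominating G S \<and> CR_set G S = CR G \<and> card S = gamma_CR G"
proof -
  have "gamma_CR G \<in> {card S |S. dominating G S \<and> CR_set G S = CR G}"
    unfolding gamma_CR_def using finite_gamma_CR_values[OF assms] CR_attained[OF assms]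
    by (intro Min_in) auto
  then show ?thesis by auto
qed

lemma gamma_CR_le_card_verts:
  assumes "simple_graph G"
  shows "gamma_CR G \<le> card (verts G)"
proof -
  obtain S where S: "dominating G S" "card S = gamma_CR G"
    using gamma_CR_attained[OF assms] by blast
  from S(1) have "S \<subseteq> verts G"
    by (simp add: dominating_def)
  with S(2) assms show ?thesis
    by (metis card_mono simple_graph_def)
qed

lemma finite_gamma_CR_image: "finite (gamma_CR ` graphs_with n k m)"
  by (rule finite_subset[of _ "{..n}"]) (auto simp: graphs_with_def dest: gamma_CR_le_card_verts)

end

theory Submission
  imports Defs
begin

text \<open>
  Upper bound.  Let \<open>G\<close> have \<open>n\<close> vertices, \<open>m\<close> edges and cardinality-redundance two.  Let \<open>S\<close> be a
  smallest dominating set with two overdominated vertices and \<open>T\<close> its complement, of size \<open>t\<close>, so that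
  \<open>\<gamma>\<^sub>C\<^sub>R = n - t\<close>.  A vertex of \<open>S\<close> is overdominated iff it has a neighbour in \<open>S\<close>, and that neighbour
  is then overdominated too; so the two overdominated vertices \<open>x, y\<close> are either both in \<open>S\<close> or
  both outside.  If both are in \<open>S\<close>, then \<open>x y\<close> is the only edge inside \<open>S\<close> and every vertex of
  \<open>T\<close> has a single neighbour in \<open>S\<close>, whence \<open>m \<le> 1 + t + (t choose 2)\<close>.  If both are outside, then \<open>S\<close> is
  independent and every other vertex of \<open>T\<close> has a single neighbour in \<open>S\<close>.  For \<open>t \<le> 3\<close> the minimality
  of \<open>S\<close> forces \<open>x\<close> and \<open>y\<close> to have few neighbours in \<open>S\<close>: deleting from \<open>S\<close> the neighbours of \<open>x\<close>
  and adding \<open>x\<close>, possibly with one more vertex, gives a dominating set with at most two overdominated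
  vertices, unless \<open>G\<close> is very restricted (lemmas \<open>exchange_hub\<close>, \<open>exchange_common\<close>,
  \<open>exchange_pendant\<close>, \<open>not_adjacent_to_both\<close>).  Together,
  \<open>t \<le> 1\<close>, \<open>t \<le> 2\<close> and \<open>t \<le> 3\<close> imply \<open>m \<le> 2\<close>, \<open>m \<le> 4\<close> and \<open>m \<le> 7\<close> respectively (lemma
  \<open>card_edges_bound\<close>).

  Lower bound.  The extremal graphs have two hubs with several common neighbours, and apart from these
  mostly isolated vertices.  For \<open>4 \<le> m \<le> 10\<close> the hubs are joined to all \<open>c\<close> vertices of a small
  graph \<open>H\<close> with an isolated vertex; every dominating set contains at least two of the \<open>c + 2\<close> vertices
  of this join and overdominates at least two.  When \<open>m = 5\<close>, one disjoint edge is added (lemma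
  \<open>join_two_hubs\<close>).  For \<open>m \<ge> 11\<close> the hubs have any number of common neighbours of degree two, and a
  triangle is attached to them in one of two ways, according to the parity of \<open>m\<close>.  There a dominating
  set that contains a hub overdominates at least three vertices, and one that avoids both hubs contains
  all the common neighbours of degree two, hence is large (lemma \<open>triangle_two_hubs\<close>).
\<close>

section \<open>Domination and overdomination in terms of adjacency\<close>

definition adj :: "'a graph \<Rightarrow> 'a \<Rightarrow> 'a \<Rightarrow> bool" where
  "adj G u v \<longleftrightarrow> {u, v} \<in> edges G"

lemma adj_sym: "adj G u v \<longleftrightarrow> adj G v u"
  by (simp add: adj_def insert_commute)

lemma adj_verts:
  assumes "simple_graph G" "adj G u v"
  shows "u \<in> verts G" "v \<in> verts G" "u \<noteq> v"
  using assms unfolding simple_graph_def adj_def by force+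

lemma edgeE:
  assumes "simple_graph G" "e \<in> edges G"
  obtains u v where "e = {u, v}" "u \<noteq> v" "u \<in> verts G" "v \<in> verts G" "adj G u v"
proof -
  have "card e = 2" "e \<subseteq> verts G" using assms by (auto simp: simple_graph_def)
  then obtain u v where "e = {u, v}" "u \<noteq> v" by (auto simp: card_2_iff)
  then show thesis using that[of u v] assms \<open>e \<subseteq> verts G\<close> by (auto simp: adj_def)
qed

lemma mem_closed_nbhd:
  assumes "simple_graph G"
  shows "v \<in> closed_nbhd G u \<longleftrightarrow> v = u \<or> adj G u v"
  using adj_verts[OF assms, of u v] by (auto simp: closed_nbhd_def adj_def)

lemma dominating_iff:
  assumes "simple_graph G"
  shows "dominating G S \<longleftrightarrow> S \<subseteq> verts G \<and> (\<forall>v\<in>verts G. v \<in> S \<or> (\<exists>s\<in>S. adj G v s))"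
  unfolding dominating_def by (auto simp: mem_closed_nbhd[OF assms] adj_sym)

lemma dominatingI:
  assumes "simple_graph G" "S \<subseteq> verts G"
    and "\<And>v. v \<in> verts G \<Longrightarrow> v \<notin> S \<Longrightarrow> \<exists>s\<in>S. adj G v s"
  shows "dominating G S"
  unfolding dominating_iff[OF assms(1)] using assms by blast

lemma overdominated_iff:
  assumes "simple_graph G" "S \<subseteq> verts G"
  shows "overdominated G S u \<longleftrightarrow> u \<in> verts G \<and>
    (\<exists>a\<in>S. \<exists>b\<in>S. a \<noteq> b \<and> (a = u \<or> adj G u a) \<and> (b = u \<or> adj G u b))"
proof -
  have "finite S" using assms finite_subset by (auto simp: simple_graph_def)
  then have "2 \<le> card (closed_nbhd G u \<inter> S) \<longleftrightarrow> (\<exists>a\<in>closed_nbhd G u \<inter> S. \<exists>b\<in>closed_nbhd G u \<inter> S. a \<noteq> b)"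
    using card_le_Suc0_iff_eq[of "closed_nbhd G u \<inter> S"] by auto
  also have "\<dots> \<longleftrightarrow> (\<exists>a\<in>S. \<exists>b\<in>S. a \<noteq> b \<and> (a = u \<or> adj G u a) \<and> (b = u \<or> adj G u b))"
    unfolding Bex_def Int_iff mem_closed_nbhd[OF assms(1)] by blast
  finally show ?thesis by (simp add: overdominated_def)
qed

lemma overdominatedI:
  assumes "simple_graph G" "S \<subseteq> verts G" "a \<in> S" "b \<in> S" "a \<noteq> b"
    and "a = u \<or> adj G u a" "b = u \<or> adj G u b"
  shows "overdominated G S u"
  using assms adj_verts(1)[OF assms(1)] unfolding overdominated_iff[OF assms(1,2)] by blast

lemma overdominatedE:
  assumes "overdominated G S u" "simple_graph G" "S \<subseteq> verts G"
  obtains a b where "u \<in> verts G" "a \<in> S" "b \<in> S" "a \<noteq> b"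
    "a = u \<or> adj G u a" "b = u \<or> adj G u b"
  using assms(1) that unfolding overdominated_iff[OF assms(2,3)] by blast

lemma finite_overdominated: "simple_graph G \<Longrightarrow> finite {u. overdominated G S u}"
  by (rule finite_subset[of _ "verts G"]) (auto simp: overdominated_def simple_graph_def)

lemma CR_le: "simple_graph G \<Longrightarrow> dominating G S \<Longrightarrow> CR G \<le> CR_set G S"
  unfolding CR_def by (rule Min_le[OF finite_CR_set_values]) auto

lemma gamma_CR_le:
  assumes "simple_graph G" "dominating G S" "CR_set G S \<le> CR G"
  shows "gamma_CR G \<le> card S"
proof -
  have "CR_set G S = CR G" using CR_le[OF assms(1,2)] assms(3) by simp
  then show ?thesis
    unfolding gamma_CR_def using assms by (intro Min_le[OF finite_gamma_CR_values]) auto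
qed

lemma gamma_CR_le_of_two:
  assumes "simple_graph G" "CR G = 2" "dominating G S"
    and "\<And>u. overdominated G S u \<Longrightarrow> u = p \<or> u = q"
  shows "gamma_CR G \<le> card S"
proof -
  have "{u. overdominated G S u} \<subseteq> {p, q}" using assms(4) by auto
  then have "card {u. overdominated G S u} \<le> card {p, q}" by (intro card_mono) auto
  also have "\<dots> \<le> 2" by (simp add: card_insert_if)
  finally show ?thesis using assms by (intro gamma_CR_le) (auto simp: CR_set_def)
qed

text \<open>A certificate for \<open>CR\<close> and \<open>gamma_CR\<close>: the set \<open>S0\<close> attains two, every dominating set
  overdominates two vertices, and the smaller ones overdominate three.\<close>

lemma CR_gamma_CR_eqI:
  assumes G: "simple_graph G" and S0: "dominating G S0"
    and over0: "\<And>u. overdominated G S0 u \<Longrightarrow> u = p \<or> u = q"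
    and two: "\<And>S. dominating G S \<Longrightarrow> \<exists>u v. u \<noteq> v \<and> overdominated G S u \<and> overdominated G S v"
    and three: "\<And>S. dominating G S \<Longrightarrow> card S < card S0 \<Longrightarrow>
      \<exists>u v w. u \<noteq> v \<and> u \<noteq> w \<and> v \<noteq> w \<and> overdominated G S u \<and> overdominated G S v \<and> overdominated G S w"
  shows "CR G = 2" "gamma_CR G = card S0"
proof -
  have ge2: "CR_set G S \<ge> 2" if S: "dominating G S" for S
  proof -
    obtain u v where "u \<noteq> v" "overdominated G S u" "overdominated G S v" using two[OF S] by blast
    then have "card {u, v} \<le> card {u. overdominated G S u}"
      by (intro card_mono finite_overdominated[OF G]) auto
    then show ?thesis using \<open>u \<noteq> v\<close> by (simp add: CR_set_def)
  qed
  have "{u. overdominated G S0 u} \<subseteq> {p, q}" using over0 by auto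
  then have "card {u. overdominated G S0 u} \<le> card {p, q}" by (intro card_mono) auto
  also have "\<dots> \<le> 2" by (simp add: card_insert_if)
  finally have le2: "CR_set G S0 \<le> 2" by (simp add: CR_set_def)
  show CR: "CR G = 2"
    using CR_attained[OF G] ge2 CR_le[OF G S0] le2 by fastforce
  have "card S \<ge> card S0" if S: "dominating G S" "CR_set G S = CR G" for S
  proof (rule ccontr)
    assume "\<not> card S \<ge> card S0"
    then obtain u v w where "u \<noteq> v" "u \<noteq> w" "v \<noteq> w"
      "overdominated G S u" "overdominated G S v" "overdominated G S w"
      using three[OF S(1)] by auto
    then have "card {u, v, w} \<le> card {u. overdominated G S u}"
      by (intro card_mono finite_overdominated[OF G]) auto
    then show False using \<open>u \<noteq> v\<close> \<open>u \<noteq> w\<close> \<open>v \<noteq> w\<close> S CR by (simp add: CR_set_def)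
  qed
  then have "gamma_CR G \<ge> card S0" using gamma_CR_attained[OF G] by metis
  moreover have "gamma_CR G \<le> card S0"
    using gamma_CR_le[OF G S0] le2 CR by simp
  ultimately show "gamma_CR G = card S0" by simp
qed

lemma D_eqI:
  assumes "G \<in> graphs_with n k m" "gamma_CR G = r"
    and "\<And>H. H \<in> graphs_with n k m \<Longrightarrow> gamma_CR H \<le> r"
  shows "D n k m = r"
proof -
  have "Max (gamma_CR ` graphs_with n k m) = r"
    using assms by (intro Max_eqI finite_gamma_CR_image) auto
  then show ?thesis using assms(1) by (auto simp: D_def)
qed


section \<open>Counting edges when the overdominated vertices lie in S\<close>

text \<open>A vertex of \<open>S\<close> is overdominated because of a neighbour in \<open>S\<close>, which is overdominated as well.\<close>

lemma overdominated_pair_inside: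
  assumes G: "simple_graph G" and SV: "S \<subseteq> verts G"
    and over: "{u. overdominated G S u} = {x, y}" and "x \<in> S"
  shows "y \<in> S"
proof -
  have "overdominated G S x" using over by auto
  then obtain a where a: "a \<in> S" "a \<noteq> x" "adj G x a"
    using \<open>x \<in> S\<close> by (auto simp: overdominated_iff[OF G SV])
  then have "overdominated G S a"
    using \<open>x \<in> S\<close> adj_sym[of G x a] by (intro overdominatedI[OF G SV, of a x]) auto
  then have "a = y" using over a by auto
  with a show ?thesis by simp
qed

text \<open>The three summands count the edge inside \<open>S\<close>, the edges between \<open>S\<close> and its complement, and
  the edges inside the complement.\<close>

lemma card_edges_overdominated_inside:
  assumes G: "simple_graph G" and dom: "dominating G S"
    and over: "{u. overdominated G S u} = {x, y}" and "x \<in> S"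
  shows "card (edges G) \<le> 1 + card (verts G - S) + (card (verts G - S) choose 2)"
proof -
  let ?T = "verts G - S"
  have SV: "S \<subseteq> verts G" using dom by (simp add: dominating_def)
  have "y \<in> S" by (rule overdominated_pair_inside[OF G SV over \<open>x \<in> S\<close>])
  have finT: "finite ?T" using G by (simp add: simple_graph_def)
  have over': "u = x \<or> u = y" if "overdominated G S u" for u using over that by auto
  have "\<forall>w\<in>?T. \<exists>s. s \<in> S \<and> adj G w s"
    using dom by (auto simp: dominating_iff[OF G])
  then obtain f where f: "\<And>w. w \<in> ?T \<Longrightarrow> f w \<in> S \<and> adj G w (f w)" by metis
  have uniq: "s = f w" if "w \<in> ?T" "s \<in> S" "adj G w s" for w s
  proof (rule ccontr)
    assume "s \<noteq> f w"
    then have "overdominated G S w" using that f[of w] by (auto simp: overdominated_iff[OF G SV])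
    then show False using over' that \<open>x \<in> S\<close> \<open>y \<in> S\<close> by auto
  qed
  have inS: "{s, s'} = {x, y}" if "s \<in> S" "s' \<in> S" "adj G s s'" for s s'
  proof -
    have "s \<noteq> s'" using adj_verts[OF G] that by blast
    then have "overdominated G S s" "overdominated G S s'"
      using that adj_sym[of G s s'] by (auto intro: overdominatedI[OF G SV, of s s'])
    then show ?thesis using over' \<open>s \<noteq> s'\<close> by auto
  qed
  let ?P = "{K. K \<subseteq> ?T \<and> card K = 2}"
  have "edges G \<subseteq> {{x, y}} \<union> (\<lambda>w. {w, f w}) ` ?T \<union> ?P"
  proof
    fix e assume "e \<in> edges G"
    then obtain u v where e: "e = {u, v}" "u \<noteq> v" "u \<in> verts G" "v \<in> verts G" "adj G u v"
      using edgeE[OF G] by metis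
    show "e \<in> {{x, y}} \<union> (\<lambda>w. {w, f w}) ` ?T \<union> ?P"
    proof (cases "u \<in> S")
      case True
      show ?thesis
      proof (cases "v \<in> S")
        case True then show ?thesis using inS e \<open>u \<in> S\<close> by auto
      next
        case False
        then have "u = f v" using uniq[of v u] e \<open>u \<in> S\<close> adj_sym[of G u v] by blast
        then show ?thesis using e False by auto
      qed
    next
      case uT: False
      show ?thesis
      proof (cases "v \<in> S")
        case True
        then have "v = f u" using uniq[of u v] e uT by auto
        then show ?thesis using e uT by auto
      next
        case False then show ?thesis using uT e by auto
      qed
    qed
  qed
  then have "card (edges G) \<le> card ({{x, y}} \<union> (\<lambda>w. {w, f w}) ` ?T \<union> ?P)"
    using finT by (intro card_mono) auto
  also have "\<dots> \<le> card {{x, y}} + card ((\<lambda>w. {w, f w}) ` ?T) + card ?P"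
    by (meson add_mono card_Un_le le_trans order_refl)
  also have "\<dots> \<le> 1 + card ?T + (card ?T choose 2)"
    using card_image_le[OF finT] n_subsets[OF finT, of 2] by (simp add: add_mono)
  finally show ?thesis .
qed

section \<open>Exchange arguments when the overdominated vertices lie outside S\<close>

text \<open>A smallest optimal dominating set \<open>S\<close> whose two overdominated vertices \<open>x\<close> and \<open>y\<close> lie outside
  \<open>S\<close>.  It suffices to assume \<open>x \<notin> S\<close>, and the situation is symmetric in \<open>x\<close> and \<open>y\<close>.\<close>

locale extremal_outside =
  fixes G :: "'a graph" and S :: "'a set" and x y :: 'a
  assumes G: "simple_graph G" and CR: "CR G = 2" and dom: "dominating G S"
    and min: "card S = gamma_CR G"
    and over: "{u. overdominated G S u} = {x, y}" and xy: "x \<noteq> y" and xS: "x \<notin> S"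
begin

lemma SV: "S \<subseteq> verts G"
  using dom by (simp add: dominating_def)

lemma finS: "finite S"
  using G SV finite_subset by (auto simp: simple_graph_def)

lemma yS: "y \<notin> S"
  using overdominated_pair_inside[OF G SV, of y x] over xS by (auto simp: insert_commute)

lemma xyV: "x \<in> verts G" "y \<in> verts G"
  using over by (auto simp: overdominated_def)

lemma irrefl: "\<not> adj G u u"
  using adj_verts(3)[OF G] by blast

lemma swap: "extremal_outside G S y x"
  using G CR dom min over xy yS by unfold_locales (auto simp: insert_commute)

lemma indep: "s \<in> S \<Longrightarrow> s' \<in> S \<Longrightarrow> \<not> adj G s s'"
proof
  assume s: "s \<in> S" "s' \<in> S" "adj G s s'"
  then have "overdominated G S s" using irrefl by (intro overdominatedI[OF G SV, of s s']) auto
  then show False using over xS yS s by auto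
qed

lemma unique_neighbour:
  assumes "v \<in> verts G" "v \<noteq> x" "v \<noteq> y" "v \<notin> S"
  obtains w where "w \<in> S" "\<And>s. s \<in> S \<Longrightarrow> adj G v s \<longleftrightarrow> s = w"
proof -
  obtain w where w: "w \<in> S" "adj G v w" using dom assms by (auto simp: dominating_iff[OF G])
  have "s = w" if "s \<in> S" "adj G v s" for s
  proof (rule ccontr)
    assume "s \<noteq> w"
    then have "overdominated G S v" using that w by (intro overdominatedI[OF G SV, of s w]) auto
    then show False using over assms by auto
  qed
  then show thesis using w that by metis
qed

lemma card_neighbours: "card {s \<in> S. adj G x s} \<ge> 2"
proof -
  have "overdominated G S x" using over by auto
  then obtain a b where "a \<in> S" "b \<in> S" "a \<noteq> b" "adj G x a" "adj G x b"
    using xS unfolding overdominated_iff[OF G SV] by blast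
  then have "card {a, b} \<le> card {s \<in> S. adj G x s}" using finS by (intro card_mono) auto
  then show ?thesis using \<open>a \<noteq> b\<close> by simp
qed

text \<open>Minimality of \<open>S\<close>: replacing \<open>A \<subseteq> S\<close> by \<open>K\<close> cannot decrease the size if the result is
  dominating and overdominates at most two vertices.\<close>

lemma exchange:
  assumes A: "A \<subseteq> S" and K: "K \<subseteq> verts G"
    and dom': "\<And>v. v \<in> verts G \<Longrightarrow> v \<notin> S - A \<union> K \<Longrightarrow> \<exists>s\<in>S - A \<union> K. adj G v s"
    and over': "\<And>u a b. u \<in> verts G \<Longrightarrow> a \<in> S - A \<union> K \<Longrightarrow> b \<in> S - A \<union> K \<Longrightarrow> a \<noteq> b \<Longrightarrow>
      a = u \<or> adj G u a \<Longrightarrow> b = u \<or> adj G u b \<Longrightarrow> u = p \<or> u = q"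
  shows "card A \<le> card K"
proof -
  have sub: "S - A \<union> K \<subseteq> verts G" using SV K by blast
  have d: "dominating G (S - A \<union> K)" by (rule dominatingI[OF G sub dom'])
  have o: "u = p \<or> u = q" if "overdominated G (S - A \<union> K) u" for u
    using that G sub by (rule overdominatedE) (rule over')
  have "card S \<le> card (S - A \<union> K)" using gamma_CR_le_of_two[OF G CR d o] min by simp
  also have "\<dots> \<le> card (S - A) + card K" by (rule card_Un_le)
  also have "card (S - A) = card S - card A"
    using A finS finite_subset by (intro card_Diff_subset) auto
  finally show ?thesis using card_mono[OF finS A] by simp
qed

text \<open>Since \<open>x\<close> has at least two neighbours in \<open>S\<close>, they cannot be replaced by \<open>x\<close> alone.  When
  the complement of \<open>S\<close> has at most three vertices, only \<open>p\<close> and \<open>q\<close> could become overdominated, so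
  some vertex \<open>v\<close> outside \<open>S\<close> must lose all its dominators.\<close>

lemma exchange_hub:
  assumes T: "verts G - S \<subseteq> {x, p, q}"
  shows "\<exists>v\<in>verts G - S. v \<noteq> x \<and> \<not> adj G x v \<and> (\<forall>s\<in>S. adj G v s \<longrightarrow> adj G x s)"
proof (rule ccontr)
  assume neg: "\<not> ?thesis"
  then have ex: "adj G x v \<or> (\<exists>s\<in>S. adj G v s \<and> \<not> adj G x s)" if "v \<in> verts G - S" "v \<noteq> x" for v
    using that by blast
  let ?A = "{s \<in> S. adj G x s}"
  have "card ?A \<le> card {x}"
  proof (rule exchange)
    show "?A \<subseteq> S" "{x} \<subseteq> verts G" using xyV by auto
    show "\<exists>s\<in>S - ?A \<union> {x}. adj G v s" if "v \<in> verts G" "v \<notin> S - ?A \<union> {x}" for v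
    proof (cases "v \<in> S")
      case True then show ?thesis using that adj_sym[of G v x] by auto
    next
      case False then show ?thesis using that ex[of v] adj_sym[of G v x] by auto
    qed
    show "u = p \<or> u = q" if ab: "u \<in> verts G" "a \<in> S - ?A \<union> {x}" "b \<in> S - ?A \<union> {x}" "a \<noteq> b"
      "a = u \<or> adj G u a" "b = u \<or> adj G u b" for u a b
    proof (rule ccontr)
      assume pq: "\<not> (u = p \<or> u = q)"
      consider "u = x" | "u \<in> S" using T ab(1) pq by blast
      then show False
      proof cases
        case 1 then show False using ab by blast
      next
        case 2
        then have "a = u \<or> a = x" "b = u \<or> b = x" using ab indep by blast+
        then show False using ab adj_sym[of G u x] 2 irrefl xS by blast
      qed
    qed
  qed
  then show False using card_neighbours by simp
qed

text \<open>Here \<open>y\<close> would be left undominated after replacing the neighbours of \<open>x\<close> by \<open>x\<close>; keeping one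
  common neighbour \<open>c\<close> repairs this, and only \<open>x\<close> and \<open>c\<close> are overdominated.  The assumption \<open>other\<close>
  says that every further vertex outside \<open>S\<close> is dominated exactly once by the new set.\<close>

lemma exchange_common:
  assumes xy': "\<not> adj G x y" and BA: "\<And>s. s \<in> S \<Longrightarrow> adj G y s \<Longrightarrow> adj G x s"
    and c: "c \<in> S" "adj G y c"
    and other: "\<And>z. z \<in> verts G - S \<Longrightarrow> z \<noteq> x \<Longrightarrow> z \<noteq> y \<Longrightarrow>
      \<not> adj G z c \<and> (adj G x z \<noteq> (\<exists>s\<in>S. adj G z s \<and> \<not> adj G x s))"
  shows "card {s \<in> S. adj G x s} \<le> 2"
proof -
  let ?A = "{s \<in> S. adj G x s}"
  have "card ?A \<le> card {x, c}"
  proof (rule exchange)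
    show "?A \<subseteq> S" "{x, c} \<subseteq> verts G" using xyV SV c by auto
    show "\<exists>s\<in>S - ?A \<union> {x, c}. adj G v s" if v: "v \<in> verts G" "v \<notin> S - ?A \<union> {x, c}" for v
    proof -
      consider "v \<in> S" | "v = y" | "v \<in> verts G - S" "v \<noteq> x" "v \<noteq> y" using v by blast
      then show ?thesis
      proof cases
        case 1 then show ?thesis using v adj_sym[of G v x] by auto
      next
        case 2 then show ?thesis using c by blast
      next
        case 3 then show ?thesis using other[OF 3] adj_sym[of G v x] by auto
      qed
    qed
    show "u = x \<or> u = c" if ab: "u \<in> verts G" "a \<in> S - ?A \<union> {x, c}" "b \<in> S - ?A \<union> {x, c}" "a \<noteq> b"
      "a = u \<or> adj G u a" "b = u \<or> adj G u b" for u a b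
    proof (rule ccontr)
      assume pq: "\<not> (u = x \<or> u = c)"
      consider "u \<in> S" | "u = y" | "u \<in> verts G - S" "u \<noteq> x" "u \<noteq> y" using ab(1) pq by blast
      then show False
      proof cases
        case 2
        then have "a = c" "b = c" using ab BA xy xy' adj_sym[of G y x] yS by blast+
        then show False using ab by simp
      next
        case 3
        obtain w where w: "w \<in> S" "\<And>s. s \<in> S \<Longrightarrow> adj G u s \<longleftrightarrow> s = w"
          by (rule unique_neighbour[of u]) (use 3 in auto)
        have "s = x \<and> adj G x u \<or> s = w \<and> \<not> adj G x w"
          if "s \<in> S - ?A \<union> {x, c}" "s = u \<or> adj G u s" for s
          using that w(2)[of s] 3 other[OF 3] c(1) adj_sym[of G u x] by auto
        from this[OF ab(2,5)] this[OF ab(3,6)] have "adj G x u" "\<not> adj G x w" using ab(4) by auto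
        then show False using other[OF 3] w by auto
      next
        case 1
        then have "a = u \<or> a = x" "b = u \<or> b = x" using ab indep c by blast+
        then show False using ab adj_sym[of G u x] 1 pq irrefl xS by blast
      qed
    qed
  qed
  then show ?thesis by (simp add: card_insert_if split: if_splits)
qed

text \<open>Minimality forces \<open>x\<close> and \<open>y\<close> to be nonadjacent with the same two neighbours, so \<open>G\<close> is a
  four-cycle together with isolated vertices.\<close>

lemma card_edges_two_outside:
  assumes T: "verts G - S = {x, y}"
  shows "card (edges G) \<le> 4"
proof -
  interpret swap: extremal_outside G S y x by (rule swap)
  let ?A = "{s \<in> S. adj G x s}"
  have "\<exists>v\<in>verts G - S. v \<noteq> x \<and> \<not> adj G x v \<and> (\<forall>s\<in>S. adj G v s \<longrightarrow> adj G x s)"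
    by (rule exchange_hub[of y y]) (use T in auto)
  then have xy': "\<not> adj G x y" and 1: "\<And>s. s \<in> S \<Longrightarrow> adj G y s \<Longrightarrow> adj G x s"
    using T by auto
  have "\<exists>v\<in>verts G - S. v \<noteq> y \<and> \<not> adj G y v \<and> (\<forall>s\<in>S. adj G v s \<longrightarrow> adj G y s)"
    by (rule swap.exchange_hub[of x x]) (use T in auto)
  then have 2: "\<And>s. s \<in> S \<Longrightarrow> adj G x s \<Longrightarrow> adj G y s"
    using T by auto
  have "?A \<noteq> {}" using card_neighbours by (metis card.empty not_numeral_le_zero)
  then obtain c where c: "c \<in> S" "adj G y c" using 2 by auto
  have a: "card ?A \<le> 2" by (rule exchange_common[OF xy' 1 c]) (use T in auto)
  have "edges G \<subseteq> (\<lambda>s. {x, s}) ` ?A \<union> (\<lambda>s. {y, s}) ` ?A"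
  proof
    fix e assume "e \<in> edges G"
    then obtain u v where e: "e = {u, v}" "u \<noteq> v" "u \<in> verts G" "v \<in> verts G" "adj G u v"
      using edgeE[OF G] by metis
    then have "adj G v u" using adj_sym by metis
    have "u \<in> S \<or> u = x \<or> u = y" "v \<in> S \<or> v = x \<or> v = y" using e T by auto
    then show "e \<in> (\<lambda>s. {x, s}) ` ?A \<union> (\<lambda>s. {y, s}) ` ?A"
      using e \<open>adj G v u\<close> indep xy' 1 by (elim disjE) (auto simp: insert_commute)
  qed
  then have "card (edges G) \<le> card ((\<lambda>s. {x, s}) ` ?A \<union> (\<lambda>s. {y, s}) ` ?A)"
    using finS by (intro card_mono) auto
  also have "\<dots> \<le> card ((\<lambda>s. {x, s}) ` ?A) + card ((\<lambda>s. {y, s}) ` ?A)"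
    by (rule card_Un_le)
  also have "\<dots> \<le> card ?A + card ?A"
    using finS by (intro add_mono card_image_le) auto
  finally show ?thesis using a by simp
qed

text \<open>Now \<open>z\<close> is a pendant vertex hanging off a common neighbour \<open>w\<close> of \<open>x\<close> and \<open>y\<close>.  The neighbours of
  \<open>x\<close> are replaced by \<open>x\<close> and \<open>z\<close> if this dominates \<open>y\<close>, and by \<open>x\<close> and \<open>w\<close> otherwise.\<close>

lemma exchange_pendant:
  assumes T: "verts G - S = {x, y, z}" and z: "z \<noteq> x" "z \<noteq> y" "\<not> adj G x z" "\<not> adj G y z"
    and w: "w \<in> S" "\<And>s. s \<in> S \<Longrightarrow> adj G z s \<longleftrightarrow> s = w" and xw: "adj G x w" and yw: "adj G y w"
  shows "card {s \<in> S. adj G x s} \<le> 2"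
proof -
  let ?A = "{s \<in> S. adj G x s}"
  have zV: "z \<in> verts G" "z \<notin> S" using T by auto
  have V: "v \<in> S \<or> v = x \<or> v = y \<or> v = z" if "v \<in> verts G" for v using T that by blast
  have nz: "\<not> adj G z x" "\<not> adj G z y" "\<And>s. s \<in> S \<Longrightarrow> adj G s z \<longleftrightarrow> s = w"
    using z w adj_sym by metis+
  show ?thesis
  proof (cases "adj G x y \<or> (\<exists>s\<in>S. adj G y s \<and> \<not> adj G x s)")
    case True
    have "card ?A \<le> card {x, z}"
    proof (rule exchange)
      show "?A \<subseteq> S" "{x, z} \<subseteq> verts G" using xyV zV by auto
      show "\<exists>s\<in>S - ?A \<union> {x, z}. adj G v s" if v: "v \<in> verts G" "v \<notin> S - ?A \<union> {x, z}" for v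
      proof (cases "v \<in> S")
        case True then show ?thesis using v adj_sym[of G v x] by auto
      next
        case False
        then have "v = y" using v V by blast
        then show ?thesis using \<open>adj G x y \<or> _\<close> adj_sym[of G y x] by auto
      qed
      show "u = y \<or> u = w" if ab: "u \<in> verts G" "a \<in> S - ?A \<union> {x, z}" "b \<in> S - ?A \<union> {x, z}" "a \<noteq> b"
        "a = u \<or> adj G u a" "b = u \<or> adj G u b" for u a b
      proof (rule ccontr)
        assume pq: "\<not> (u = y \<or> u = w)"
        consider "u \<in> S" | "u = x" | "u = z" using V[OF ab(1)] pq by blast
        then show False
        proof cases
          case 1
          then have "a = u \<or> a = x" "b = u \<or> b = x" using ab indep nz(3) pq by blast+
          then show False using ab adj_sym[of G u x] 1 irrefl xS zV by blast
        next
          case 2 then show False using ab z by blast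
        next
          case 3 then show False using ab nz w xw by blast
        qed
      qed
    qed
    then show ?thesis by (simp add: card_insert_if split: if_splits)
  next
    case False
    have "card ?A \<le> card {x, w}"
    proof (rule exchange)
      show "?A \<subseteq> S" "{x, w} \<subseteq> verts G" using xyV w SV by auto
      show "\<exists>s\<in>S - ?A \<union> {x, w}. adj G v s" if v: "v \<in> verts G" "v \<notin> S - ?A \<union> {x, w}" for v
      proof (cases "v \<in> S")
        case True then show ?thesis using v adj_sym[of G v x] by auto
      next
        case False
        then have "adj G v w" using v V[OF v(1)] yw w by blast
        then show ?thesis by blast
      qed
      show "u = x \<or> u = w" if ab: "u \<in> verts G" "a \<in> S - ?A \<union> {x, w}" "b \<in> S - ?A \<union> {x, w}" "a \<noteq> b"
        "a = u \<or> adj G u a" "b = u \<or> adj G u b" for u a b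
      proof (rule ccontr)
        assume pq: "\<not> (u = x \<or> u = w)"
        consider "u \<in> S" | "u = y" | "u = z" using V[OF ab(1)] pq by blast
        then show False
        proof cases
          case 1
          then have "a = u \<or> a = x" "b = u \<or> b = x" using ab indep w by blast+
          then show False using ab adj_sym[of G u x] 1 irrefl xS pq by blast
        next
          case 2
          then have "a = w" "b = w" using ab False adj_sym[of G y x] xy yS by blast+
          then show False using ab by blast
        next
          case 3
          then have "a = w" "b = w" using ab nz w z zV by blast+
          then show False using ab by blast
        qed
      qed
    qed
    then show ?thesis by (simp add: card_insert_if split: if_splits)
  qed
qed

text \<open>If \<open>x\<close> and \<open>y\<close> were nonadjacent, their common neighbours, at least two in number, together with
  \<open>w\<close> could be replaced by the two vertices \<open>x\<close> and \<open>z\<close>.\<close>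

lemma not_adjacent_to_both:
  assumes T: "verts G - S = {x, y, z}" and z: "z \<noteq> x" "z \<noteq> y" "adj G x z" "adj G y z"
    and w: "w \<in> S" "\<And>s. s \<in> S \<Longrightarrow> adj G z s \<longleftrightarrow> s = w" and xw: "\<not> adj G x w"
    and AB: "\<And>s. s \<in> S \<Longrightarrow> adj G y s \<longleftrightarrow> adj G x s"
  shows "adj G x y"
proof (rule ccontr)
  assume xy': "\<not> adj G x y"
  let ?A = "{s \<in> S. adj G x s}"
  have zV: "z \<in> verts G" "z \<notin> S" using T by auto
  have V: "v \<in> S \<or> v = x \<or> v = y \<or> v = z" if "v \<in> verts G" for v using T that by blast
  have nz: "adj G z x" "adj G z y" "\<And>s. s \<in> S \<Longrightarrow> adj G s z \<longleftrightarrow> s = w"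
    using z w adj_sym by metis+
  have "card (insert w ?A) \<le> card {x, z}"
  proof (rule exchange)
    show "insert w ?A \<subseteq> S" "{x, z} \<subseteq> verts G" using xyV zV w by auto
    show "\<exists>s\<in>S - insert w ?A \<union> {x, z}. adj G v s"
      if v: "v \<in> verts G" "v \<notin> S - insert w ?A \<union> {x, z}" for v
    proof (cases "v \<in> S")
      case True then show ?thesis using v adj_sym[of G v x] nz(3) by auto
    next
      case False
      then have "v = y" using v V by blast
      then show ?thesis using z by blast
    qed
    show "u = x \<or> u = z" if ab: "u \<in> verts G" "a \<in> S - insert w ?A \<union> {x, z}"
      "b \<in> S - insert w ?A \<union> {x, z}" "a \<noteq> b" "a = u \<or> adj G u a" "b = u \<or> adj G u b" for u a b
    proof (rule ccontr)
      assume pq: "\<not> (u = x \<or> u = z)"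
      consider "u \<in> S" "u \<noteq> w" | "u = w" | "u = y" using V[OF ab(1)] pq by blast
      then show False
      proof cases
        case 1
        then have "a = u \<or> a = x" "b = u \<or> b = x" using ab indep nz(3) by blast+
        then show False using ab adj_sym[of G u x] 1 irrefl xS zV by blast
      next
        case 2
        then have "a = z" "b = z" using ab indep w xw adj_sym[of G w x] xS by blast+
        then show False using ab by blast
      next
        case 3
        then have "a = z" "b = z" using ab AB xy' adj_sym[of G y x] xy yS by blast+
        then show False using ab by blast
      qed
    qed
  qed
  moreover have "card (insert w ?A) = Suc (card ?A)" using finS xw by simp
  ultimately show False using card_neighbours z by simp
qed

text \<open>In every case at most four edges join \<open>S\<close> to \<open>x\<close> and \<open>y\<close>, one edge joins \<open>S\<close> to \<open>z\<close>, and \<open>x, y, z\<close> do not span a triangle.\<close>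

lemma card_edges_three_outside:
  assumes T: "verts G - S = {x, y, z}" and z: "z \<noteq> x" "z \<noteq> y"
  shows "card (edges G) \<le> 7"
proof -
  interpret swap: extremal_outside G S y x by (rule swap)
  let ?A = "{s \<in> S. adj G x s}" and ?B = "{s \<in> S. adj G y s}"
  have T': "verts G - S = {y, x, z}" using T by auto
  obtain w where w: "w \<in> S" "\<And>s. s \<in> S \<Longrightarrow> adj G z s \<longleftrightarrow> s = w"
    by (rule unique_neighbour[of z]) (use T z in auto)
  have sym: "adj G y x \<longleftrightarrow> adj G x y" by (rule adj_sym)
  \<comment> \<open>The vertex that blocks the exchange at \<open>x\<close> is \<open>y\<close> or \<open>z\<close>; likewise at \<open>y\<close>.\<close>
  have x: "\<not> adj G x y \<and> ?B \<subseteq> ?A \<or> \<not> adj G x z \<and> adj G x w"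
    using exchange_hub[of y z] T w by auto
  have y: "\<not> adj G x y \<and> ?A \<subseteq> ?B \<or> \<not> adj G y z \<and> adj G y w"
    using swap.exchange_hub[of x z] T w sym by auto
  have other_vertex: "\<exists>c\<in>C. c \<noteq> w" if "card C \<ge> 2" for C
  proof (rule ccontr)
    assume "\<not> ?thesis"
    then have "C \<subseteq> {w}" by blast
    then have "card C \<le> card {w}" by (intro card_mono) auto
    then show False using that by simp
  qed
  obtain a where a: "a \<in> S" "adj G x a" "\<not> adj G z a" using other_vertex[OF card_neighbours] w by blast
  obtain b where b: "b \<in> S" "adj G y b" "\<not> adj G z b" using other_vertex[OF swap.card_neighbours] w by blast
  have commonA: "card ?A \<le> 2" if "\<not> adj G x y" "?B \<subseteq> ?A" "adj G x z \<longleftrightarrow> adj G x w"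
    by (rule exchange_common[OF that(1) _ b(1,2)]) (use that b T w in auto)
  have commonB: "card ?B \<le> 2" if "\<not> adj G x y" "?A \<subseteq> ?B" "adj G y z \<longleftrightarrow> adj G y w"
    by (rule swap.exchange_common[OF _ _ a(1,2)]) (use that a T w sym in auto)
  have pend: "card ?A \<le> 2" "card ?B \<le> 2" if "\<not> adj G x z" "\<not> adj G y z" "adj G x w" "adj G y w"
    using exchange_pendant[OF T z that(1,2) w that(3,4)]
      swap.exchange_pendant[OF T' z(2,1) that(2,1) w that(4,3)] by auto
  have mono: "?A \<subseteq> ?B \<Longrightarrow> card ?A \<le> card ?B" "?B \<subseteq> ?A \<Longrightarrow> card ?B \<le> card ?A"
    using finS by (auto intro: card_mono)
  have nab: False if "\<not> adj G x y" "?A = ?B" "adj G x z" "adj G y z" "\<not> adj G x w"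
    using not_adjacent_to_both[OF T z that(3,4) w that(5)] that(1,2) by blast
  have ab: "card ?A + card ?B \<le> 4"
  proof (cases "adj G x w")
    case True
    show ?thesis
    proof (cases "adj G y w")
      case yw: True
      consider "\<not> adj G x z" "\<not> adj G y z" | "adj G x z" | "adj G y z" by blast
      then show ?thesis
      proof cases
        case 1 then show ?thesis using pend True yw by simp
      next
        case 2
        then have "\<not> adj G x y" "?B \<subseteq> ?A" using x by auto
        moreover have "card ?A \<le> 2" by (rule commonA) (use calculation 2 True in auto)
        ultimately show ?thesis using mono(2) by linarith
      next
        case 3
        then have "\<not> adj G x y" "?A \<subseteq> ?B" using y by auto
        moreover have "card ?B \<le> 2" by (rule commonB) (use calculation 3 yw in auto)
        ultimately show ?thesis using mono(1) by linarith
      qed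
    next
      case False
      then have "\<not> adj G x y" "?A \<subseteq> ?B" using y by auto
      then show ?thesis using True False w by blast
    qed
  next
    case False
    then have 1: "\<not> adj G x y" "?B \<subseteq> ?A" using x by auto
    then have "\<not> adj G y w" using False w(1) by blast
    then have 2: "?A \<subseteq> ?B" using y by auto
    have eq: "?A = ?B" using 1(2) 2 by (rule equalityI[rotated])
    have "\<not> (adj G x z \<and> adj G y z)" using nab[OF 1(1) eq] False by blast
    then have "card ?A \<le> 2 \<or> card ?B \<le> 2"
      using commonA[OF 1] commonB[OF 1(1) 2] False \<open>\<not> adj G y w\<close> by blast
    then show ?thesis using eq by simp
  qed
  have missing: "card (edges G \<inter> {{x, y}, {x, z}, {y, z}}) \<le> 2"
  proof -
    have "edges G \<inter> {{x, y}, {x, z}, {y, z}} \<subseteq> {{x, z}, {y, z}} \<or>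
      edges G \<inter> {{x, y}, {x, z}, {y, z}} \<subseteq> {{x, y}, {y, z}}"
      using x by (auto simp: adj_def)
    moreover have "card {{x, z}, {y, z}} \<le> 2" "card {{x, y}, {y, z}} \<le> 2"
      by (simp_all add: card_insert_if)
    ultimately show ?thesis by (meson card_mono finite.emptyI finite.insertI le_trans)
  qed
  have "edges G \<subseteq> (\<lambda>s. {x, s}) ` ?A \<union> (\<lambda>s. {y, s}) ` ?B \<union> {{z, w}}
    \<union> (edges G \<inter> {{x, y}, {x, z}, {y, z}})"
  proof
    fix e assume "e \<in> edges G"
    then obtain u v where e: "e = {u, v}" "u \<noteq> v" "u \<in> verts G" "v \<in> verts G" "adj G u v"
      using edgeE[OF G] by metis
    then have "adj G v u" using adj_sym by metis
    have "u \<in> S \<or> u = x \<or> u = y \<or> u = z" "v \<in> S \<or> v = x \<or> v = y \<or> v = z" using e T by auto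
    then show "e \<in> (\<lambda>s. {x, s}) ` ?A \<union> (\<lambda>s. {y, s}) ` ?B \<union> {{z, w}}
      \<union> (edges G \<inter> {{x, y}, {x, z}, {y, z}})"
      using e \<open>e \<in> edges G\<close> \<open>adj G v u\<close> indep w
      by (elim disjE) (auto simp: insert_commute)
  qed
  then have "card (edges G) \<le> card ((\<lambda>s. {x, s}) ` ?A \<union> (\<lambda>s. {y, s}) ` ?B \<union> {{z, w}}
    \<union> (edges G \<inter> {{x, y}, {x, z}, {y, z}}))"
    using finS by (intro card_mono) auto
  also have "\<dots> \<le> card ((\<lambda>s. {x, s}) ` ?A) + card ((\<lambda>s. {y, s}) ` ?B) + card {{z, w}}
    + card (edges G \<inter> {{x, y}, {x, z}, {y, z}})"
    by (meson add_mono card_Un_le le_trans order_refl)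
  also have "\<dots> \<le> card ?A + card ?B + 1 + 2"
    using finS missing by (intro add_mono card_image_le) auto
  finally show ?thesis using ab by simp
qed

end

lemma card_edges_bound:
  assumes G: "simple_graph G" and CR: "CR G = 2"
  shows "card (verts G) \<le> gamma_CR G + 1 \<Longrightarrow> card (edges G) \<le> 2"
    and "card (verts G) \<le> gamma_CR G + 2 \<Longrightarrow> card (edges G) \<le> 4"
    and "card (verts G) \<le> gamma_CR G + 3 \<Longrightarrow> card (edges G) \<le> 7"
proof -
  obtain S where dom: "dominating G S" and CRS: "CR_set G S = 2" and min: "card S = gamma_CR G"
    using gamma_CR_attained[OF G] CR by metis
  define t where "t = card (verts G - S)"
  have SV: "S \<subseteq> verts G" using dom by (simp add: dominating_def)
  have finV: "finite (verts G)" using G by (simp add: simple_graph_def)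
  have n: "card (verts G) = gamma_CR G + t"
    using SV finV min card_mono[OF finV SV] by (simp add: t_def card_Diff_subset finite_subset)
  obtain x y where xy: "x \<noteq> y" and over: "{u. overdominated G S u} = {x, y}"
    using CRS by (auto simp: CR_set_def card_2_iff)
  have "(t \<le> 1 \<longrightarrow> card (edges G) \<le> 2) \<and> (t = 2 \<longrightarrow> card (edges G) \<le> 4) \<and>
    (t = 3 \<longrightarrow> card (edges G) \<le> 7)"
  proof (cases "x \<in> S")
    case True
    have "card (edges G) \<le> 1 + t + (t choose 2)"
      unfolding t_def by (rule card_edges_overdominated_inside[OF G dom over True])
    moreover have "t = 0 \<or> t = 1" if "t \<le> 1" using that by auto
    ultimately show ?thesis by (auto simp: choose_two)
  next
    case False
    interpret extremal_outside G S x y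
      using G CR dom min over xy False by unfold_locales
    have finT: "finite (verts G - S)" using finV by simp
    have sub: "{x, y} \<subseteq> verts G - S" using xS yS xyV by auto
    have t2: "t \<ge> 2" using card_mono[OF finT sub] xy by (simp add: t_def)
    have "card (edges G) \<le> 4" if "t = 2"
    proof (rule card_edges_two_outside)
      show "verts G - S = {x, y}"
        using card_subset_eq[OF finT sub] that xy by (simp add: t_def)
    qed
    moreover have "card (edges G) \<le> 7" if "t = 3"
    proof -
      have "card (verts G - S - {x, y}) = 1"
        using that sub xy by (simp add: t_def card_Diff_subset)
      then obtain z where "verts G - S - {x, y} = {z}" by (auto simp: card_1_singleton_iff)
      then have "verts G - S = {x, y, z}" "z \<noteq> x" "z \<noteq> y" using sub by auto
      then show ?thesis by (rule card_edges_three_outside)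
    qed
    ultimately show ?thesis using t2 by auto
  qed
  moreover have "t \<le> 1 \<or> t = 2 \<or> t = 3" if "t \<le> 3" using that by auto
  ultimately show "card (verts G) \<le> gamma_CR G + 1 \<Longrightarrow> card (edges G) \<le> 2"
    and "card (verts G) \<le> gamma_CR G + 2 \<Longrightarrow> card (edges G) \<le> 4"
    and "card (verts G) \<le> gamma_CR G + 3 \<Longrightarrow> card (edges G) \<le> 7"
    using n by auto
qed

section \<open>Graphs with two hubs joined to a common part\<close>

text \<open>The graph on the vertices \<open>0, \<dots>, n - 1\<close> whose edges are given by a set of pairs; the pairs are
  increasing in all uses, so that distinct pairs give distinct edges.\<close>

definition pair_graph :: "nat \<Rightarrow> (nat \<times> nat) set \<Rightarrow> nat graph" where
  "pair_graph n P = ({..<n}, (\<lambda>(i, j). {i, j}) ` P)"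

lemma pair_graph:
  assumes "\<forall>(i, j)\<in>P. i < j \<and> j < n"
  shows "simple_graph (pair_graph n P)" "verts (pair_graph n P) = {..<n}"
    "card (edges (pair_graph n P)) = card P"
    "adj (pair_graph n P) u v \<longleftrightarrow> (u, v) \<in> P \<or> (v, u) \<in> P"
proof -
  show "simple_graph (pair_graph n P)"
    using assms by (fastforce simp: simple_graph_def pair_graph_def)
  have "inj_on (\<lambda>(i, j). {i, j}) P"
  proof (rule inj_onI)
    fix p q assume pq: "p \<in> P" "q \<in> P" "(case p of (i, j) \<Rightarrow> {i, j}) = (case q of (i, j) \<Rightarrow> {i, j})"
    obtain i j k l where ij: "p = (i, j)" "q = (k, l)" by (metis surj_pair)
    then have "i < j" "k < l" using pq assms by auto
    then show "p = q" using pq(3) by (auto simp: ij doubleton_eq_iff)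
  qed
  then show "card (edges (pair_graph n P)) = card P"
    by (simp add: pair_graph_def card_image)
qed (auto simp: pair_graph_def adj_def doubleton_eq_iff image_iff Bex_def)

lemma pair_graphs_with:
  assumes "\<forall>(i, j)\<in>P. i < j \<and> j < n" "CR (pair_graph n P) = k" "card P = m"
  shows "pair_graph n P \<in> graphs_with n k m"
  using pair_graph[OF assms(1)] assms(2,3) by (simp add: graphs_with_def)

text \<open>The hubs \<open>0\<close> and \<open>1\<close> are joined to all of \<open>2, \<dots>, c + 1\<close>, on which \<open>H\<close> is a graph with the
  isolated vertex \<open>c + 1\<close>.  The remaining vertices carry at most the single edge \<open>L\<close>.  A dominating set
  contains two of the first \<open>c + 2\<close> vertices; conversely \<open>0\<close> and \<open>c + 1\<close> dominate all of them and are
  the only ones overdominated by these two.\<close>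

lemma join_two_hubs:
  fixes n c :: nat and H L :: "(nat \<times> nat) set"
  assumes c: "2 \<le> c" and n: "c + 2 \<le> n"
    and H: "\<And>i j. (i, j) \<in> H \<Longrightarrow> 2 \<le> i \<and> i < j \<and> j \<le> c"
    and L: "L = {} \<or> L = {(c + 2, c + 3)} \<and> c + 4 \<le> n"
  defines "P \<equiv> {0, 1} \<times> {2..<c + 2} \<union> H \<union> L"
  shows "pair_graph n P \<in> graphs_with n 2 (2 * c + card H + card L)"
    and "gamma_CR (pair_graph n P) = n - c - card L"
proof -
  let ?G = "pair_graph n P"
  have P: "\<forall>(i, j)\<in>P. i < j \<and> j < n"
    using H L n by (fastforce simp: P_def)
  note G = pair_graph[OF P]
  have a0: "adj ?G 0 v \<longleftrightarrow> 2 \<le> v \<and> v < c + 2" "adj ?G v 0 \<longleftrightarrow> 2 \<le> v \<and> v < c + 2" for v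
    using H[of 0 v] H[of v 0] L unfolding G by (auto simp: P_def)
  have a1: "adj ?G (Suc 0) v \<longleftrightarrow> 2 \<le> v \<and> v < c + 2" "adj ?G v (Suc 0) \<longleftrightarrow> 2 \<le> v \<and> v < c + 2" for v
    using H[of 1 v] H[of v 1] L unfolding G by (auto simp: P_def)
  have al: "adj ?G (Suc c) v \<longleftrightarrow> v \<le> 1" "adj ?G v (Suc c) \<longleftrightarrow> v \<le> 1" for v
    using H[of "Suc c" v] H[of v "Suc c"] L c unfolding G by (auto simp: P_def)
  have aC: "adj ?G u v \<Longrightarrow> 2 \<le> u \<Longrightarrow> u < c + 2 \<Longrightarrow> v < c + 2"
    and aR: "adj ?G u v \<Longrightarrow> c + 2 \<le> u \<Longrightarrow> L = {(c + 2, c + 3)} \<and> {u, v} = {c + 2, c + 3}" for u v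
    using H[of u v] H[of v u] L unfolding G by (auto simp: P_def)
  have aL: "adj ?G (c + 2) (c + 3)" if "L \<noteq> {}" using that L unfolding G by (auto simp: P_def)
  \<comment> \<open>A minimum dominating set of the part outside the join.\<close>
  define R where "R = {c + 2..<n} - (if L = {} then {} else {c + 3})"
  have cardR: "card R = n - c - 2 - card L"
    using L n by (auto simp: R_def)
  let ?S = "{0, Suc c} \<union> R"
  have cardS: "card ?S = n - c - card L"
  proof -
    have "card ?S = card {0, Suc c} + card R"
      by (rule card_Un_disjoint) (auto simp: R_def)
    then show ?thesis using cardR L n by auto
  qed
  have sub: "?S \<subseteq> verts ?G" using n c by (auto simp: G R_def)
  have dom: "dominating ?G ?S"
  proof (rule dominatingI[OF G(1) sub])
    fix v assume v: "v \<in> verts ?G" "v \<notin> ?S"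
    have "v \<noteq> 0" "v < n" "v \<notin> R" using v by (auto simp: G)
    then have "v = 1 \<or> 2 \<le> v \<and> v < c + 2 \<or> L \<noteq> {} \<and> v = c + 3"
      by (auto simp: R_def split: if_splits)
    then consider "v = 1" | "2 \<le> v" "v < c + 2" | "L \<noteq> {}" "v = c + 3" by blast
    then show "\<exists>s\<in>?S. adj ?G v s"
    proof cases
      case 1 then show ?thesis by (auto simp: al)
    next
      case 2 then show ?thesis by (auto simp: a0)
    next
      case 3 then show ?thesis using aL adj_sym[of ?G "c + 2" "c + 3"] L by (auto simp: R_def)
    qed
  qed
  have over: "u = 0 \<or> u = Suc c" if "overdominated ?G ?S u" for u
    using that G(1) sub
  proof (rule overdominatedE)
    fix a b assume ab: "u \<in> verts ?G" "a \<in> ?S" "b \<in> ?S" "a \<noteq> b"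
      "a = u \<or> adj ?G u a" "b = u \<or> adj ?G u b"
    show ?thesis
    proof (rule ccontr)
      assume u: "\<not> ?thesis"
      have "u \<noteq> 0" "u \<noteq> Suc c" using u by simp_all
      then have "u = 1 \<or> 2 \<le> u \<and> u < Suc c \<or> c + 2 \<le> u" by linarith
      then consider "u = 1" | "2 \<le> u" "u < Suc c" | "c + 2 \<le> u" by metis
      then show False
      proof cases
        case 1
        then have "s = Suc c" if "s \<in> ?S" "s = u \<or> adj ?G u s" for s
          using that by (auto simp: R_def a1)
        then show False using ab by metis
      next
        case 2
        then have "s = 0" if "s \<in> ?S" "s = u \<or> adj ?G u s" for s
          using that aC[of u s] by (auto simp: R_def al)
        then show False using ab by metis
      next
        case 3
        have "s \<in> R \<and> (s = u \<or> L \<noteq> {} \<and> s = c + 2 \<and> u = c + 3)"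
          if "s \<in> ?S" "s = u \<or> adj ?G u s" for s
          using that aR[of u s] 3 by (auto simp: R_def doubleton_eq_iff a0 al split: if_splits)
        from this[OF ab(2,5)] this[OF ab(3,6)] ab(4) show False by (auto simp: R_def split: if_splits)
      qed
    qed
  qed
  have bound: "(\<exists>u v. u \<noteq> v \<and> overdominated ?G S u \<and> overdominated ?G S v) \<and> card ?S \<le> card S"
    if S: "dominating ?G S" for S
  proof -
    have SV: "S \<subseteq> {..<n}" and d: "\<And>v. v < n \<Longrightarrow> v \<in> S \<or> (\<exists>s\<in>S. adj ?G v s)"
      using S by (auto simp: dominating_iff[OF G(1)] G)
    then have SV': "S \<subseteq> verts ?G" and finS: "finite S" by (auto simp: G finite_subset)
    note O = overdominatedI[OF G(1) SV']
    have "\<exists>a b u v. a < c + 2 \<and> b < c + 2 \<and> a \<in> S \<and> b \<in> S \<and> a \<noteq> b \<and>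
      u \<noteq> v \<and> overdominated ?G S u \<and> overdominated ?G S v"
    proof -
      \<comment> \<open>If exactly one hub \<open>h\<close> lies in \<open>S\<close>, then \<open>1 - h\<close> is the other one.\<close>
      consider "0 \<in> S" "1 \<in> S" | h where "h \<in> S" "h \<le> 1" "1 - h \<notin> S" | "0 \<notin> S" "1 \<notin> S"
      proof (cases "0 \<in> S"; cases "1 \<in> S")
        assume "0 \<in> S" "1 \<notin> S" then show thesis by (intro that(2)[of 0]) auto
      next
        assume "0 \<notin> S" "1 \<in> S" then show thesis by (intro that(2)[of 1]) auto
      next
        assume "0 \<in> S" "1 \<in> S" then show thesis by (rule that(1))
      next
        assume "0 \<notin> S" "1 \<notin> S" then show thesis by (rule that(3))
      qed
      then show ?thesis
      proof cases
        case 1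
        have "overdominated ?G S 2" "overdominated ?G S 3"
          by (rule O[of 0 1]; use 1 c in \<open>simp add: a0 a1\<close>)+
        then show ?thesis using 1 c
          by (intro exI[of _ 0] exI[of _ 1] exI[of _ 2] exI[of _ 3]) auto
      next
        case 2
        have h: "adj ?G h v \<longleftrightarrow> 2 \<le> v \<and> v < c + 2" "adj ?G (1 - h) v \<longleftrightarrow> 2 \<le> v \<and> v < c + 2"
          "adj ?G v h \<longleftrightarrow> 2 \<le> v \<and> v < c + 2" for v
          using 2(2) by (cases "h = 0"; auto simp: le_Suc_eq a0 a1)+
        have "1 - h < n" using n by linarith
        then obtain e where e: "e \<in> S" "2 \<le> e" "e < c + 2" using d[of "1 - h"] 2(3) h(2) by blast
        have "overdominated ?G S h" "overdominated ?G S e"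
          by (rule O[of h e]; use 2 e in \<open>auto simp: h\<close>)+
        then show ?thesis using 2 e
          by (intro exI[of _ h] exI[of _ e]) auto
      next
        case 3
        obtain e where e: "e \<in> S" "2 \<le> e" "e < c + 2" using d[of 0] 3 n by (auto simp: a0)
        have "\<exists>f. f \<in> S \<and> 2 \<le> f \<and> f < c + 2 \<and> f \<noteq> e"
        proof (cases "e = Suc c")
          case True
          have "s \<noteq> Suc c \<and> 2 \<le> s \<and> s < c + 2" if "s \<in> S" "s = 2 \<or> adj ?G 2 s" for s
          proof -
            have "s \<noteq> 0" "s \<noteq> 1" using that 3 by metis+
            then show ?thesis using that aC[of 2 s] c by (auto simp: al)
          qed
          moreover have "\<exists>s\<in>S. s = 2 \<or> adj ?G 2 s" using d[of 2] n c by auto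
          ultimately show ?thesis using True by metis
        next
          case False
          have "Suc c \<in> S" using d[of "Suc c"] 3 n by (auto simp: al le_Suc_eq)
          then show ?thesis using False c by (intro exI[of _ "Suc c"]) auto
        qed
        then obtain f where f: "f \<in> S" "2 \<le> f" "f < c + 2" "f \<noteq> e" by blast
        have "overdominated ?G S 0" "overdominated ?G S 1"
          by (rule O[of e f]; use e f in \<open>simp add: a0 a1\<close>)+
        then show ?thesis using e f
          by (intro exI[of _ e] exI[of _ f] exI[of _ 0] exI[of _ 1]) auto
      qed
    qed
    then obtain a b u v where ab: "a < c + 2" "b < c + 2" "a \<in> S" "b \<in> S" "a \<noteq> b"
      and uv: "u \<noteq> v" "overdominated ?G S u" "overdominated ?G S v" by metis
    \<comment> \<open>If \<open>L\<close> is an edge, then \<open>S\<close> may contain its end \<open>c + 3\<close> instead of \<open>c + 2\<close>.\<close>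
    obtain r where r: "r ` R \<subseteq> S" "inj_on r R" "\<And>i. i \<in> R \<Longrightarrow> c + 2 \<le> r i"
    proof (cases "L \<noteq> {} \<and> c + 3 \<in> S")
      case True
      have "i \<in> S" if "i \<in> R" "i \<noteq> c + 2" for i
        using d[of i] aR[of i] that True by (auto simp: R_def doubleton_eq_iff)
      then have "(\<lambda>i. if i = c + 2 then c + 3 else i) ` R \<subseteq> S" using True by auto
      then show thesis using True
        by (elim that) (auto simp: inj_on_def R_def split: if_splits)
    next
      case False
      have "i \<in> S" if "i \<in> R" for i
        using d[of i] aR[of i] that False by (auto simp: R_def doubleton_eq_iff split: if_splits)
      then show thesis
        by (intro that[of id]) (auto simp: R_def)
    qed
    have "{a, b} \<inter> r ` R = {}" using ab(1,2) r(3) by fastforce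
    then have "card ({a, b} \<union> r ` R) = card {a, b} + card R"
      using r(2) by (subst card_Un_disjoint) (auto simp: R_def card_image)
    moreover have "card ?S \<le> card {0, Suc c} + card R" by (rule card_Un_le)
    moreover have "card ({a, b} \<union> r ` R) \<le> card S"
      using ab r(1) finS by (intro card_mono) auto
    ultimately have "card ?S \<le> card S" using ab(5) by simp
    then show ?thesis using uv by blast
  qed
  have "CR ?G = 2" "gamma_CR ?G = card ?S"
    using CR_gamma_CR_eqI[OF G(1) dom over] bound by (meson not_le)+
  moreover have "card P = 2 * c + card H + card L"
  proof -
    have finH: "finite H" by (rule finite_subset[of _ "{..c} \<times> {..c}"]) (use H in force)+
    have disj: "({0, 1} \<times> {2..<c + 2}) \<inter> H = {}" "({0, 1} \<times> {2..<c + 2} \<union> H) \<inter> L = {}"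
      using H L by fastforce+
    show ?thesis unfolding P_def using disj finH L by (subst card_Un_disjoint; auto simp: card_Un_disjoint)
  qed
  ultimately show "?G \<in> graphs_with n 2 (2 * c + card H + card L)" "gamma_CR ?G = n - c - card L"
    using pair_graphs_with[OF P] cardS by auto
qed

section \<open>Graphs with a triangle attached to two hubs\<close>

text \<open>The vertices \<open>5, \<dots>, c + 4\<close> are common neighbours of the hubs \<open>0\<close> and \<open>1\<close>, the vertices \<open>2, 3, 4\<close> form
  a triangle, and \<open>X\<close> attaches the triangle to the hubs, with nonadjacent hubs in the first variant and
  adjacent ones in the second.  A dominating set that contains a hub overdominates three vertices; one
  that contains no hub contains a vertex of the triangle and all vertices from \<open>5\<close> onwards.\<close>

lemma triangle_two_hubs:
  fixes n c :: nat and X :: "(nat \<times> nat) set"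
  assumes c: "2 \<le> c" and n: "c + 5 \<le> n"
    and X: "X = {(0, 2), (0, 3), (1, 2), (1, 3)} \<or> X = {(0, 1), (0, 2), (1, 2), (0, 3), (1, 4)}"
  defines "P \<equiv> {0, 1} \<times> {5..<c + 5} \<union> {(2, 3), (2, 4), (3, 4)} \<union> X"
  shows "pair_graph n P \<in> graphs_with n 2 (2 * c + 3 + card X)"
    and "gamma_CR (pair_graph n P) = n - 4"
proof -
  let ?G = "pair_graph n P"
  define hubs_adj where "hubs_adj \<longleftrightarrow> (0, 1) \<in> X"
  have P: "\<forall>(i, j)\<in>P. i < j \<and> j < n"
    using X n by (auto simp: P_def)
  note G = pair_graph[OF P]
  have X': "X = (if hubs_adj then {(0, 1), (0, 2), (1, 2), (0, 3), (1, 4)} else {(0, 2), (0, 3), (1, 2), (1, 3)})"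
    using X by (elim disjE) (simp_all add: hubs_adj_def)
  have mem: "(u, v) \<in> P \<longleftrightarrow> (u = 0 \<or> u = 1) \<and> 5 \<le> v \<and> v < c + 5 \<or> u = 2 \<and> v = 3 \<or> u = 2 \<and> v = 4 \<or>
    u = 3 \<and> v = 4 \<or> u = 0 \<and> v = 2 \<or> u = 0 \<and> v = 3 \<or> u = 1 \<and> v = 2 \<or>
    (if hubs_adj then u = 0 \<and> v = 1 \<or> u = 1 \<and> v = 4 else u = 1 \<and> v = 3)" for u v
  proof (cases hubs_adj)
    case True
    show ?thesis unfolding P_def X'
      by (simp only: True if_True Un_iff insert_iff empty_iff mem_Times_iff prod.inject fst_conv snd_conv atLeastLessThan_iff) blast
  next
    case False
    show ?thesis unfolding P_def X'
      by (simp only: False if_False Un_iff insert_iff empty_iff mem_Times_iff prod.inject fst_conv snd_conv atLeastLessThan_iff) blast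
  qed
  have a0: "adj ?G 0 v \<longleftrightarrow> 5 \<le> v \<and> v < c + 5 \<or> v = 2 \<or> v = 3 \<or> v = 1 \<and> hubs_adj"
    and a1: "adj ?G (Suc 0) v \<longleftrightarrow> 5 \<le> v \<and> v < c + 5 \<or> v = 2 \<or> (if hubs_adj then v = 0 \<or> v = 4 else v = 3)"
    and a2: "adj ?G 2 v \<longleftrightarrow> v = 0 \<or> v = 1 \<or> v = 3 \<or> v = 4"
    and a3: "adj ?G 3 v \<longleftrightarrow> v = 0 \<or> v = 1 \<and> \<not> hubs_adj \<or> v = 2 \<or> v = 4"
    and a4: "adj ?G 4 v \<longleftrightarrow> v = 1 \<and> hubs_adj \<or> v = 2 \<or> v = 3" for v
    unfolding G(4) mem by auto
  have aR: "adj ?G u v \<longleftrightarrow> u < c + 5 \<and> v \<le> 1" if "5 \<le> u" for u v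
    using that unfolding G(4) mem by auto
  let ?S = "{4..<n}"
  have sub: "?S \<subseteq> verts ?G" by (auto simp: G)
  have dom: "dominating ?G ?S"
  proof (rule dominatingI[OF G(1) sub])
    fix v assume "v \<in> verts ?G" "v \<notin> ?S"
    then have "v = 0 \<or> v = 1 \<or> v = 2 \<or> v = 3" by (auto simp: G)
    then have "adj ?G v 5 \<or> adj ?G v 4" using c by (auto simp: a0 a1 a2 a3)
    moreover have "4 \<in> ?S" "5 \<in> ?S" using n c by simp_all
    ultimately show "\<exists>s\<in>?S. adj ?G v s" by blast
  qed
  have over: "u = 0 \<or> u = 1" if "overdominated ?G ?S u" for u
    using that G(1) sub
  proof (rule overdominatedE)
    fix a b assume ab: "u \<in> verts ?G" "a \<in> ?S" "b \<in> ?S" "a \<noteq> b"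
      "a = u \<or> adj ?G u a" "b = u \<or> adj ?G u b"
    show ?thesis
    proof (rule ccontr)
      assume u: "\<not> ?thesis"
      have "s = (if u = 2 \<or> u = 3 then 4 else u)" if "s \<in> ?S" "s = u \<or> adj ?G u s" for s
      proof -
        have "u = 2 \<or> u = 3 \<or> u = 4 \<or> 5 \<le> u" using u by auto
        then show ?thesis using that by (elim disjE) (auto simp: a2 a3 a4 aR)
      qed
      then show False using ab by metis
    qed
  qed
  have bound: "(\<exists>u v w. u \<noteq> v \<and> u \<noteq> w \<and> v \<noteq> w \<and> overdominated ?G S u \<and> overdominated ?G S v \<and>
      overdominated ?G S w) \<or> overdominated ?G S 0 \<and> overdominated ?G S 1 \<and> card ?S \<le> card S"
    if S: "dominating ?G S" for S
  proof -
    have SV: "S \<subseteq> {..<n}" and d: "\<And>v. v < n \<Longrightarrow> \<exists>s\<in>S. s = v \<or> adj ?G v s"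
      using S by (auto simp: dominating_iff[OF G(1)] G)
    then have SV': "S \<subseteq> verts ?G" and finS: "finite S" by (auto simp: G finite_subset)
    have O: "overdominated ?G S u"
      if "a \<in> S" "b \<in> S" "a \<noteq> b" "a = u \<or> adj ?G u a" "b = u \<or> adj ?G u b" for a b u
      using overdominatedI[OF G(1) SV'] that by blast
    define Q where "Q \<longleftrightarrow> (\<exists>u v w. u \<noteq> v \<and> u \<noteq> w \<and> v \<noteq> w \<and>
      overdominated ?G S u \<and> overdominated ?G S v \<and> overdominated ?G S w)"
    \<comment> \<open>In most cases two members \<open>a, b\<close> of \<open>S\<close> are responsible for three overdominated vertices.\<close>
    have QI: "Q" if "a \<in> S" "b \<in> S" "a \<noteq> b" "u \<noteq> v" "u \<noteq> w" "v \<noteq> w"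
      "a = u \<or> adj ?G u a" "b = u \<or> adj ?G u b" "a = v \<or> adj ?G v a" "b = v \<or> adj ?G v b"
      "a = w \<or> adj ?G w a" "b = w \<or> adj ?G w b" for a b u v w
      unfolding Q_def using O[OF that(1-3,7,8)] O[OF that(1-3,9,10)] O[OF that(1-3,11,12)] that by blast
    have "0 < n" "1 < n" "2 < n" "3 < n" "4 < n" using n by auto
    note d' = d[OF this(1)] d[OF this(2)] d[OF this(3)] d[OF this(4)] d[OF this(5)]
    show ?thesis
    proof (cases "0 \<in> S \<or> 1 \<in> S")
      case True
      then consider "0 \<in> S" "1 \<in> S" | "hubs_adj" "0 \<in> S" "1 \<notin> S" | "hubs_adj" "0 \<notin> S" "1 \<in> S"
        | h where "\<not> hubs_adj" "h = 0 \<or> h = 1" "h \<in> S" "1 - h \<notin> S"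
        by (metis diff_self_eq_0 diff_zero)
      then have Q
      proof cases
        case 1
        show ?thesis
          by (rule QI[OF 1, of 2 5 "if hubs_adj then 0 else 3"])
            (use c in \<open>simp_all add: a0 a1 a2 a3 aR\<close>)
      next
        case 2
        consider "2 \<in> S" | "3 \<in> S" | "4 \<in> S" using d'(5) 2 by (auto simp: a4)
        then show ?thesis
        proof cases
          case t: 1 show ?thesis
            by (rule QI[OF 2(2) t, of 0 2 1]) (use 2 in \<open>simp_all add: a0 a1 a2 a3 a4\<close>)
        next
          case t: 2 show ?thesis
            by (rule QI[OF 2(2) t, of 0 2 3]) (use 2 in \<open>simp_all add: a0 a1 a2 a3 a4\<close>)
        next
          case t: 3 show ?thesis
            by (rule QI[OF 2(2) t, of 1 2 3]) (use 2 in \<open>simp_all add: a0 a1 a2 a3 a4\<close>)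
        qed
      next
        case 3
        consider "2 \<in> S" | "3 \<in> S" | "4 \<in> S" using d'(4) 3 by (auto simp: a3)
        then show ?thesis
        proof cases
          case t: 1 show ?thesis
            by (rule QI[OF 3(3) t, of 0 2 1]) (use 3 in \<open>simp_all add: a0 a1 a2 a3 a4\<close>)
        next
          case t: 2 show ?thesis
            by (rule QI[OF 3(3) t, of 0 2 4]) (use 3 in \<open>simp_all add: a0 a1 a2 a3 a4\<close>)
        next
          case t: 3 show ?thesis
            by (rule QI[OF 3(3) t, of 1 2 4]) (use 3 in \<open>simp_all add: a0 a1 a2 a3 a4\<close>)
        qed
      next
        case 4
        have h: "adj ?G h v \<longleftrightarrow> 5 \<le> v \<and> v < c + 5 \<or> v = 2 \<or> v = 3"
          "adj ?G (1 - h) v \<longleftrightarrow> 5 \<le> v \<and> v < c + 5 \<or> v = 2 \<or> v = 3"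
          "adj ?G 2 h" "adj ?G 3 h" "h \<noteq> 2" "h \<noteq> 3" "h \<noteq> 4" for v
          using 4(1,2) by (auto simp: a0 a1 a2 a3)
        consider "2 \<in> S" | "3 \<in> S" | "4 \<in> S" using d'(5) 4 by (auto simp: a4)
        then show ?thesis
        proof cases
          case t: 1 show ?thesis
            by (rule QI[OF 4(3) t, of h 2 3]) (use 4 in \<open>simp_all add: h a2 a3\<close>)
        next
          case t: 2 show ?thesis
            by (rule QI[OF 4(3) t, of h 2 3]) (use 4 in \<open>simp_all add: h a2 a3\<close>)
        next
          case t: 3
          have "1 - h < n" using n by linarith
          then obtain s where s: "s \<in> S" "adj ?G (1 - h) s" using d[of "1 - h"] 4(4) by blast
          then have "adj ?G h s" using h(1,2) by blast
          then have "overdominated ?G S h"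
            using O[OF 4(3) s(1)] adj_verts(3)[OF G(1)] by blast
          moreover have "overdominated ?G S 2" "overdominated ?G S 3"
            using O[OF 4(3) t] h by (simp_all add: a2 a3)
          ultimately show ?thesis unfolding Q_def using h(5,6)
            by (intro exI[of _ h] exI[of _ 2] exI[of _ 3]) simp
        qed
      qed
      then show ?thesis by (simp add: Q_def)
    next
      case False
      have R: "i \<in> S" if "5 \<le> i" "i < n" for i
      proof -
        obtain s where "s \<in> S" "s = i \<or> adj ?G i s" using d[OF \<open>i < n\<close>] by blast
        then show ?thesis using False that by (auto simp: aR le_Suc_eq)
      qed
      obtain s where s: "s \<in> S" "2 \<le> s" "s \<le> 4" 
        using d'(5) False by (auto simp: a4)
      have "card (insert s {5..<n}) \<le> card S"
        using s R finS by (intro card_mono) auto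
      then have "card ?S \<le> card S" using s n by simp
      moreover have "5 \<in> S" "6 \<in> S" using R n c by auto
      then have "overdominated ?G S 0" "overdominated ?G S 1"
        using O[of 5 6] c by (auto simp: a0 a1)
      ultimately show ?thesis by blast
    qed
  qed
  have two: "\<exists>u v. u \<noteq> v \<and> overdominated ?G S u \<and> overdominated ?G S v" if "dominating ?G S" for S
    using bound[OF that] zero_neq_one[where 'a = nat] by blast
  have three: "\<exists>u v w. u \<noteq> v \<and> u \<noteq> w \<and> v \<noteq> w \<and>
      overdominated ?G S u \<and> overdominated ?G S v \<and> overdominated ?G S w"
    if "dominating ?G S" "card S < card ?S" for S
    using bound[OF that(1)] that(2) leD by blast
  have "CR ?G = 2" "gamma_CR ?G = card ?S"
    using CR_gamma_CR_eqI[OF G(1) dom over two three] by blast+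
  moreover have "card P = 2 * c + 3 + card X"
  proof -
    have "finite X" using X by auto
    have disj: "({0, 1} \<times> {5..<c + 5}) \<inter> {(2, 3), (2, 4), (3, 4)} = {}"
      "({0, 1} \<times> {5..<c + 5} \<union> {(2, 3), (2, 4), (3, 4)}) \<inter> X = {}"
      using X by auto
    then show ?thesis unfolding P_def using disj \<open>finite X\<close> by (simp add: card_Un_disjoint)
  qed
  ultimately show "?G \<in> graphs_with n 2 (2 * c + 3 + card X)" "gamma_CR ?G = n - 4"
    using pair_graphs_with[OF P] by auto
qed

section \<open>The values of D\<close>

theorem theorem6p5:
  fixes n m :: nat
  assumes "n \<ge> 8"
  shows "(m = 4 \<longrightarrow> D n 2 m = n - 2) \<and>
         (5 \<le> m \<and> m \<le> 7 \<longrightarrow> D n 2 m = n - 3) \<and>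
         (8 \<le> m \<and> m \<le> 2 * (n - 6) + 10 \<longrightarrow> D n 2 m = n - 4)"
proof -
  have upper: "3 \<le> m \<Longrightarrow> gamma_CR G \<le> n - 2" "5 \<le> m \<Longrightarrow> gamma_CR G \<le> n - 3"
    "8 \<le> m \<Longrightarrow> gamma_CR G \<le> n - 4" if "G \<in> graphs_with n 2 m" for G
  proof -
    have "simple_graph G" "CR G = 2" and nm: "card (verts G) = n" "card (edges G) = m"
      using that by (auto simp: graphs_with_def)
    note b = card_edges_bound[OF this(1,2), unfolded nm]
    show "3 \<le> m \<Longrightarrow> gamma_CR G \<le> n - 2" "5 \<le> m \<Longrightarrow> gamma_CR G \<le> n - 3"
      "8 \<le> m \<Longrightarrow> gamma_CR G \<le> n - 4"
      using b by linarith+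
  qed
  have D_eq2: "D n 2 m = n - 2" if "\<exists>G\<in>graphs_with n 2 m. gamma_CR G = n - 2" "m = 4"
    using that upper(1) by (auto intro: D_eqI)
  have D_eq3: "D n 2 m = n - 3" if "\<exists>G\<in>graphs_with n 2 m. gamma_CR G = n - 3" "5 \<le> m"
    using that upper(2) by (auto intro: D_eqI)
  have D_eq4: "D n 2 m = n - 4" if "\<exists>G\<in>graphs_with n 2 m. gamma_CR G = n - 4" "8 \<le> m"
    using that upper(3) by (auto intro: D_eqI)
  have join: "\<exists>G\<in>graphs_with n 2 (2 * c + card H + card L). gamma_CR G = n - c - card L"
    if "2 \<le> c" "c + 2 \<le> n" "\<forall>(i, j)\<in>H. 2 \<le> i \<and> i < j \<and> j \<le> c"
      "L = {} \<or> L = {(c + 2, c + 3)} \<and> c + 4 \<le> n" for c :: nat and H L :: "(nat \<times> nat) set"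
  proof -
    have H: "2 \<le> i \<and> i < j \<and> j \<le> c" if "(i, j) \<in> H" for i j
      using \<open>\<forall>(i, j)\<in>H. _\<close> that by blast
    show ?thesis
      using join_two_hubs(2)[OF that(1,2) H that(4)] join_two_hubs(1)[OF that(1,2) H that(4)]
      by (rule bexI)
  qed
  have "D n 2 m = n - 2" if m: "m = 4"
  proof (rule D_eq2[OF _ m])
    show "\<exists>G\<in>graphs_with n 2 m. gamma_CR G = n - 2"
      using join[of 2 "{}" "{}"] assms m by simp
  qed
  moreover have "D n 2 m = n - 3" if m: "5 \<le> m" "m \<le> 7"
  proof (rule D_eq3[OF _ m(1)])
    consider "m = 5" | "m = 6" | "m = 7" using m by linarith
    then show "\<exists>G\<in>graphs_with n 2 m. gamma_CR G = n - 3"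
    proof cases
      case 1 then show ?thesis using join[of 2 "{}" "{(4, 5)}"] assms by simp
    next
      case 2 then show ?thesis using join[of 3 "{}" "{}"] assms by simp
    next
      case 3 then show ?thesis using join[of 3 "{(2, 3)}" "{}"] assms by simp
    qed
  qed
  moreover have "D n 2 m = n - 4" if m: "8 \<le> m" "m \<le> 2 * (n - 6) + 10"
  proof (rule D_eq4[OF _ m(1)])
    have "m = 8 \<or> m = 9 \<or> m = 10 \<or> 11 \<le> m \<and> odd m \<or> 12 \<le> m \<and> even m"
      using m(1) by presburger
    then consider "m = 8" | "m = 9" | "m = 10" | "11 \<le> m" "odd m" | "12 \<le> m" "even m"
      by blast
    then show "\<exists>G\<in>graphs_with n 2 m. gamma_CR G = n - 4"
    proof cases
      case 1 then show ?thesis using join[of 4 "{}" "{}"] assms by simp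
    next
      case 2 then show ?thesis using join[of 4 "{(2, 3)}" "{}"] assms by simp
    next
      case 3 then show ?thesis using join[of 4 "{(2, 3), (3, 4)}" "{}"] assms by simp
    next
      case 4
      define c where "c = (m - 7) div 2"
      have c: "m = 2 * c + 7" using 4 unfolding c_def by presburger
      have "2 \<le> c" "c + 5 \<le> n" using c 4 m assms by linarith+
      note G = triangle_two_hubs[OF this disjI1[OF refl]]
      show ?thesis by (rule bexI, rule G(2)) (use G(1) c in \<open>simp add: add.commute\<close>)
    next
      case 5
      define c where "c = (m - 8) div 2"
      have c: "m = 2 * c + 8" using 5 unfolding c_def by presburger
      have "2 \<le> c" "c + 5 \<le> n" using c 5 m assms by linarith+
      note G = triangle_two_hubs[OF this disjI2[OF refl]]
      show ?thesis by (rule bexI, rule G(2)) (use G(1) c in \<open>simp add: add.commute\<close>)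
    qed
  qed
  ultimately show ?thesis by blast
qed

end
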